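(* Let $\rho:[0,+\infty)\to\mathbb{R}$ satisfy: (AS1) $\rho(0)=0$, $\rho(s)<+\infty$ for all $s<+\infty$, and $0$ is the strict minimizer of $\rho$; (AS2) $\rho$ is increasing on $[0,+\infty)$. Put $\varphi(x)=\rho(|x|)$, $x\in\mathbb{R}$. Let $\nabla_x$ be the forward difference operator with Neumann boundary condition, let $\alpha>0$, $\sigma>0$, let $A$ be a real $K\times N$ matrix with $i$-th column $a_i\neq0$, let $\tilde u\in\mathbb{R}^N$ be a fixed signal, and let $f=A\tilde u+n$ where $n=(n_1,\dots,n_K)$ has i.i.d. entries $n_j\sim\mathcal{N}(0,\sigma^2)$. Let $$E(u)=\sum_{1\le i\le N}\varphi((\nabla_x u)_i)+\frac{\alpha}{2}\|Au-f\|_{\mathbb{R}^K}^2,\qquad u\in\mathbb{R}^N.$$ For $i=1,\dots,N$ set $$\mathcal{P}_i=\Phi\left(\frac{\sup\{g:\ g\in\partial\varphi((\nabla_x\tilde u)_{i-1})-\partial\varphi((\nabla_x\tilde u)_i)\}}{\alpha\sigma|a_i|_2}\right)-\Phi\left(\frac{\inf\{g:\ g\in\partial\varphi((\nabla_x\tilde u)_{i-1})-\partial\varphi((\nabla_x\tilde u)_i)\}}{\alpha\sigma|a_i|_2}\right),$$ where $\Phi$ is the cumulative distribution function of the standard normal distribution. Then: (1) $\mathcal{P}(\tilde u\in\arg\min_u E(u))\le\min\{\mathcal{P}_i:\ i=1,\dots,N\}$; (2) if $A=I$ (denoising problem), then $\mathcal{P}(\tilde u\in\arg\min_u E(u))\le\prod_{i=1}^N\mathcal{P}_i$,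 with $|a_i|_2=1$ for all $i$. In addition, if $\varphi$ is continuously differentiable everywhere, then $\mathcal{P}(\tilde u\in\arg\min_u E(u))=0$.
   Context: "Increasing" is meant in the non-strict sense. The forward difference operator with Neumann boundary condition is $(\nabla_x u)_i=u_{i+1}-u_i$ for $1\le i\le N-1$ and $(\nabla_x u)_N=0$, with the convention $(\nabla_x u)_0=0$. $|\cdot|_2$ and $\|\cdot\|_{\mathbb{R}^K}$ are Euclidean norms; $\Phi(-\infty)=0$, $\Phi(+\infty)=1$; $S-T=\{s-t:s\in S,t\in T\}$ for sets $S,T\subset\mathbb{R}$. $\mathcal{P}(\cdot)$ is probability with respect to the random noise $n$, and $\arg\min_u E(u)$ is the set of global minimizers of $E$ over $\mathbb{R}^N$. For $h:\mathbb{R}^d\to(-\infty,+\infty]$ proper and $h(z)<+\infty$, the limiting sub-differential $\partial h(z)$ is the set of all $z_*\in\mathbb{R}^d$ for which there exist sequences $z^k\to z$, $z_*^k\to z_*$ with $h(z^k)\to h(z)$ and $$\liminf_{v\to z^k,\,v\neq z^k}\frac{h(v)-h(z^k)-\langle z_*^k,v-z^k\rangle}{\|v-z^k\|}\ge0\quad\text{for all }k.$$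
   Formalization: If the set of subgradient differences is empty (possible, e.g. where ρ has infinite slope), the formula for P_i is undefined, or equals −1 with sup ∅ = −∞ and inf ∅ = +∞, which makes the claim false; in that case P_i is taken to be 0. *)

theory Defs
  imports "HOL-Probability.Probability" "Jordan_Normal_Form.Matrix"
begin

unbundle no vec_syntax and no inner_syntax

definition regular_subgradient :: "('a::euclidean_space \<Rightarrow> ereal) \<Rightarrow> 'a \<Rightarrow> 'a \<Rightarrow> bool" where
  "regular_subgradient h z g \<longleftrightarrow>
     \<bar>h z\<bar> \<noteq> \<infinity> \<and>
     0 \<le> Liminf (at z) (\<lambda>v. (h v - h z - ereal (inner g (v - z))) / ereal (norm (v - z)))"

definition limiting_subdiff :: "('a::euclidean_space \<Rightarrow> ereal) \<Rightarrow> 'a \<Rightarrow> 'a set" where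
  "limiting_subdiff h z =
     {g. \<bar>h z\<bar> \<noteq> \<infinity> \<and>
         (\<exists>zs gs. zs \<longlonglongrightarrow> z \<and> gs \<longlonglongrightarrow> g \<and> (\<lambda>k. h (zs k)) \<longlonglongrightarrow> h z \<and>
                  (\<forall>k. regular_subgradient h (zs k) (gs k)))}"

definition vec_norm2 :: "real vec \<Rightarrow> real" where
  "vec_norm2 v = sqrt (v \<bullet> v)"

text \<open>The index \<open>i\<close> of \<open>fwd_diff\<close> is one-based (\<open>1 \<le> i \<le> N\<close>, with the convention that the
  value is 0 at \<open>i = 0\<close>), while vectors are indexed from 0: \<open>u\<^sub>i\<close> is \<open>u $ (i - 1)\<close>.\<close>

definition fwd_diff :: "real vec \<Rightarrow> nat \<Rightarrow> real" where
  "fwd_diff u i = (if 1 \<le> i \<and> i < dim_vec u then u $ i - u $ (i - 1) else 0)"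

definition potential :: "(real \<Rightarrow> real) \<Rightarrow> real \<Rightarrow> real" where
  "potential \<rho> x = \<rho> \<bar>x\<bar>"

definition energy ::
  "(real \<Rightarrow> real) \<Rightarrow> real \<Rightarrow> real mat \<Rightarrow> real vec \<Rightarrow> real vec \<Rightarrow> real" where
  "energy \<rho> \<alpha> A f u =
     (\<Sum>i = 1..dim_vec u. potential \<rho> (fwd_diff u i)) + \<alpha> / 2 * (vec_norm2 (A *\<^sub>v u - f))\<^sup>2"

definition global_minimizers :: "nat \<Rightarrow> (real vec \<Rightarrow> real) \<Rightarrow> real vec set" where
  "global_minimizers N F = {u \<in> carrier_vec N. \<forall>v \<in> carrier_vec N. F u \<le> F v}"

definition std_normal_cdf :: "ereal \<Rightarrow> real" where
  "std_normal_cdf x =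
     (if x = \<infinity> then 1 else if x = -\<infinity> then 0
      else cdf std_normal_distribution (real_of_ereal x))"

definition subdiff_gap :: "(real \<Rightarrow> real) \<Rightarrow> real vec \<Rightarrow> nat \<Rightarrow> real set" where
  "subdiff_gap \<rho> u i =
     {s - t | s t.
        s \<in> limiting_subdiff (\<lambda>x. ereal (potential \<rho> x)) (fwd_diff u (i - 1)) \<and>
        t \<in> limiting_subdiff (\<lambda>x. ereal (potential \<rho> x)) (fwd_diff u i)}"

definition recovery_prob ::
  "'w measure \<Rightarrow> (nat \<Rightarrow> 'w \<Rightarrow> real) \<Rightarrow> (real \<Rightarrow> real) \<Rightarrow> real \<Rightarrow> real mat \<Rightarrow> real vec \<Rightarrow> real" where
  "recovery_prob M n \<rho> \<alpha> A u =
     measure M {\<omega> \<in> space M.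
       let f = A *\<^sub>v u + vec (dim_row A) (\<lambda>j. n j \<omega>)
       in u \<in> global_minimizers (dim_col A) (energy \<rho> \<alpha> A f)}"

text \<open>The number \<open>prob_bound \<rho> \<alpha> \<sigma> A u i\<close> is the probability that a normal variable with mean 0 and
  standard deviation \<open>\<alpha> * \<sigma> * vec_norm2 (col A (i - 1))\<close> lies between the infimum and the supremum
  of \<open>subdiff_gap \<rho> u i\<close>. Since \<open>\<rho>\<close> need not be regular, the limiting subdifferential may be empty
  at a nonzero point; the empty gap gets probability 0. (With \<open>Sup {} = -\<infinity>\<close> and \<open>Inf {} = \<infinity>\<close> the
  difference of the two values of the distribution function would be -1.)\<close>

definition prob_bound ::
  "(real \<Rightarrow> real) \<Rightarrow> real \<Rightarrow> real \<Rightarrow> real mat \<Rightarrow> real vec \<Rightarrow> nat \<Rightarrow> real" where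
  "prob_bound \<rho> \<alpha> \<sigma> A u i =
     (if subdiff_gap \<rho> u i = {} then 0
      else std_normal_cdf ((SUP g \<in> subdiff_gap \<rho> u i. ereal g)
                             / ereal (\<alpha> * \<sigma> * vec_norm2 (col A (i - 1))))
         - std_normal_cdf ((INF g \<in> subdiff_gap \<rho> u i. ereal g)
                             / ereal (\<alpha> * \<sigma> * vec_norm2 (col A (i - 1)))))"

end

theory Submission
  imports Defs
begin

text \<open>If \<open>u0\<close> minimizes the energy, then it does so along every line \<open>u0 + t \<cdot> v\<close> where \<open>v\<close> is the
  indicator vector of the indices \<open>\<ge> k\<close>. Along this line only the \<open>k\<close>-th difference changes, and it
  changes by \<open>t\<close>, so minimality says that \<open>g\<^sub>k = \<alpha> \<langle>A v, n\<rangle>\<close> is a regular subgradient of the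
  potential at that difference. Subtracting consecutive \<open>g\<^sub>k\<close> gives
  \<open>\<alpha> \<langle>a\<^sub>i, n\<rangle> = g\<^sub>i\<^sub>-\<^sub>1 - g\<^sub>i\<close>, hence this normal variable lies between the infimum and the supremum of
  the gap; no sum or chain rule for subdifferentials is needed. For \<open>A = I\<close> these variables are the
  independent entries of the noise.\<close>

section \<open>Subgradients\<close>

text \<open>After division by \<open>\<bar>v - x\<bar>\<close> the quadratic error leaves only
  \<open>- C * \<bar>v - x\<bar>\<close>, which tends to 0. The shape fits the energy, whose data
  term is quadratic in the step length.\<close>

lemma regular_subgradientI_quadratic:
  fixes \<phi> :: "real \<Rightarrow> real"
  assumes "\<And>t. 0 \<le> \<phi> (x + t) - \<phi> x - g * t + C * t\<^sup>2"
  shows "regular_subgradient (\<lambda>x. ereal (\<phi> x)) x g"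
proof -
  have "Liminf (at x) (\<lambda>v. ereal (- C * \<bar>v - x\<bar>)) = ereal (- C * \<bar>x - x\<bar>)"
    by (rule lim_imp_Liminf, simp, intro tendsto_intros)
  then have "0 = Liminf (at x) (\<lambda>v. ereal (- C * \<bar>v - x\<bar>))"
    by simp
  also have "\<dots> \<le> Liminf (at x) (\<lambda>v. (ereal (\<phi> v) - ereal (\<phi> x) - ereal (inner g (v - x)))
      / ereal (norm (v - x)))"
  proof (rule Liminf_mono, unfold eventually_at_filter, intro always_eventually allI impI)
    fix v assume "v \<noteq> x"
    then have pos: "\<bar>v - x\<bar> > 0"
      by simp
    have "- C * \<bar>v - x\<bar> * \<bar>v - x\<bar> \<le> \<phi> v - \<phi> x - g * (v - x)"
      using assms[of "v - x"] by (simp add: power2_eq_square mult.assoc)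
    then have "- C * \<bar>v - x\<bar> \<le> (\<phi> v - \<phi> x - g * (v - x)) / \<bar>v - x\<bar>"
      using pos by (simp add: pos_le_divide_eq)
    then show "ereal (- C * \<bar>v - x\<bar>) \<le> (ereal (\<phi> v) - ereal (\<phi> x) - ereal (inner g (v - x)))
      / ereal (norm (v - x))"
      using pos by simp
  qed
  finally show ?thesis
    by (simp add: regular_subgradient_def)
qed

lemma regular_subgradient_imp_limiting:
  assumes "regular_subgradient h z g"
  shows "g \<in> limiting_subdiff h z"
proof -
  have "\<bar>h z\<bar> \<noteq> \<infinity>"
    using assms by (simp add: regular_subgradient_def)
  moreover have "(\<lambda>_::nat. z) \<longlonglongrightarrow> z" "(\<lambda>_::nat. g) \<longlonglongrightarrow> g" "(\<lambda>_::nat. h z) \<longlonglongrightarrow> h z"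
    by (rule tendsto_const)+
  ultimately show ?thesis
    using assms unfolding limiting_subdiff_def by blast
qed

text \<open>For every \<open>e > 0\<close> the difference quotient is at least \<open>g - e\<close>
  just to the right of \<open>z\<close> and at most \<open>g + e\<close> just to the left, where
  division by \<open>v - z\<close> reverses the inequality. Both one-sided limits are
  \<open>D\<close>.\<close>

lemma regular_subgradient_deriv:
  fixes \<phi> :: "real \<Rightarrow> real"
  assumes D: "(\<phi> has_real_derivative D) (at z)"
    and g: "regular_subgradient (\<lambda>x. ereal (\<phi> x)) z g"
  shows "g = D"
proof -
  have slope: "((\<lambda>v. (\<phi> v - \<phi> z) / (v - z)) \<longlongrightarrow> D) (at z)"
    using D by (simp add: has_field_derivative_iff)
  \<comment> \<open>The nonnegative lower limit becomes a linear bound near \<open>z\<close>,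
    cleared of the division so that both sides of \<open>z\<close> can use it.\<close>
  have ev: "eventually (\<lambda>v. v \<noteq> z \<and> \<phi> v - \<phi> z - g * (v - z) \<ge> - e * \<bar>v - z\<bar>) (at z)"
    if "e > 0" for e
  proof -
    have "ereal (- e) < 0"
      using that by simp
    also have "0 \<le> Liminf (at z) (\<lambda>v. (ereal (\<phi> v) - ereal (\<phi> z) - ereal (inner g (v - z)))
      / ereal (norm (v - z)))"
      using g unfolding regular_subgradient_def by blast
    finally have
      "eventually (\<lambda>v. ereal (- e) < (ereal (\<phi> v) - ereal (\<phi> z) - ereal (inner g (v - z)))
        / ereal (norm (v - z))) (at z)"
      by (rule less_LiminfD)
    moreover have "eventually (\<lambda>v. v \<noteq> z) (at z)"
      by (simp add: eventually_at_filter)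
    ultimately show ?thesis
    proof eventually_elim
      case (elim v)
      then have "\<bar>v - z\<bar> > 0"
        by simp
      moreover have "- e < (\<phi> v - \<phi> z - g * (v - z)) / \<bar>v - z\<bar>"
        using elim by simp
      ultimately have "- e * \<bar>v - z\<bar> < \<phi> v - \<phi> z - g * (v - z)"
        by (simp add: pos_less_divide_eq)
      with elim show ?case
        by simp
    qed
  qed
  have "g \<le> D + e" if "e > 0" for e
  proof -
    have "g - e \<le> D"
    proof (rule tendsto_lowerbound)
      show "((\<lambda>v. (\<phi> v - \<phi> z) / (v - z)) \<longlongrightarrow> D) (at_right z)"
        using slope by (simp add: filterlim_at_split)
      have "eventually (\<lambda>v. v \<noteq> z \<and> \<phi> v - \<phi> z - g * (v - z) \<ge> - e * \<bar>v - z\<bar>) (at_right z)"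
        using ev[OF that] by (simp add: eventually_at_split)
      moreover have "eventually (\<lambda>v. v > z) (at_right z)"
        by (simp add: eventually_at_filter)
      ultimately show "eventually (\<lambda>v. g - e \<le> (\<phi> v - \<phi> z) / (v - z)) (at_right z)"
      proof eventually_elim
        case (elim v)
        then have "(g - e) * (v - z) \<le> \<phi> v - \<phi> z"
          by (simp add: algebra_simps)
        with elim show ?case
          by (simp only: pos_le_divide_eq diff_gt_0_iff_gt)
      qed
    qed simp
    then show ?thesis
      by simp
  qed
  moreover have "D \<le> g + e" if "e > 0" for e
  proof (rule tendsto_upperbound)
    show "((\<lambda>v. (\<phi> v - \<phi> z) / (v - z)) \<longlongrightarrow> D) (at_left z)"
      using slope by (simp add: filterlim_at_split)
    have "eventually (\<lambda>v. v \<noteq> z \<and> \<phi> v - \<phi> z - g * (v - z) \<ge> - e * \<bar>v - z\<bar>) (at_left z)"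
      using ev[OF that] by (simp add: eventually_at_split)
    moreover have "eventually (\<lambda>v. v < z) (at_left z)"
      by (simp add: eventually_at_filter)
    ultimately show "eventually (\<lambda>v. (\<phi> v - \<phi> z) / (v - z) \<le> g + e) (at_left z)"
    proof eventually_elim
      case (elim v)
      then have "(g + e) * (v - z) \<le> \<phi> v - \<phi> z"
        by (simp add: algebra_simps)
      with elim show ?case
        by (simp only: neg_divide_le_eq diff_less_0_iff_less)
    qed
  qed simp
  ultimately show ?thesis
    using field_le_epsilon[of g D] field_le_epsilon[of D g] by fastforce
qed

text \<open>Differentiability forces the regular subgradients along the approximating sequence to be
  \<open>D (zs k)\<close>, and continuity of \<open>D\<close> passes to the limit. The inclusion is
  enough to confine the gap to a single point.\<close>

lemma limiting_subdiff_C1: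
  fixes \<phi> :: "real \<Rightarrow> real"
  assumes D: "\<And>x. (\<phi> has_real_derivative D x) (at x)" and cont: "continuous_on UNIV D"
  shows "limiting_subdiff (\<lambda>x. ereal (\<phi> x)) z \<subseteq> {D z}"
proof
  fix g assume "g \<in> limiting_subdiff (\<lambda>x. ereal (\<phi> x)) z"
  then obtain zs gs where zs: "zs \<longlonglongrightarrow> z" and gs: "gs \<longlonglongrightarrow> g"
    and reg: "\<And>k. regular_subgradient (\<lambda>x. ereal (\<phi> x)) (zs k) (gs k)"
    unfolding limiting_subdiff_def by auto
  have "gs = (\<lambda>k. D (zs k))"
    using regular_subgradient_deriv[OF D reg] by auto
  moreover have "(\<lambda>k. D (zs k)) \<longlonglongrightarrow> D z"
    using cont zs by (auto simp: continuous_on_eq_continuous_at intro: isCont_tendsto_compose)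
  ultimately show "g \<in> {D z}"
    using gs LIMSEQ_unique by blast
qed

section \<open>Optimality along the columns\<close>

text \<open>Entries are counted from 0, so \<open>k \<le> j\<close> selects the one-based components
  after the \<open>k\<close>-th; the jump is seen by the one-based difference number
  \<open>k\<close>. For \<open>k = 0\<close> this is the all-ones vector, for \<open>k = N\<close>
  the zero vector.\<close>

definition tail_vec :: "nat \<Rightarrow> nat \<Rightarrow> real vec" where
  "tail_vec N k = vec N (\<lambda>j. if k \<le> j then 1 else 0)"

lemma tail_vec_carrier [simp]: "tail_vec N k \<in> carrier_vec N"
  by (simp add: tail_vec_def)

text \<open>The bound \<open>1 \<le> i\<close> excludes \<open>i = k = 0\<close>, where the
  right-hand side would add \<open>t\<close> to a difference that is 0 by convention. The test
  \<open>k < N\<close> reflects the Neumann condition at the other end.\<close>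

lemma fwd_diff_add_tail_vec:
  assumes "u \<in> carrier_vec N" "1 \<le> i"
  shows "fwd_diff (u + t \<cdot>\<^sub>v tail_vec N k) i = fwd_diff u i + (if i = k \<and> k < N then t else 0)"
  using assms by (auto simp: fwd_diff_def tail_vec_def)

lemma sum_potential_add_tail_vec:
  assumes "u \<in> carrier_vec N"
  shows "(\<Sum>i = 1..N. potential \<rho> (fwd_diff (u + t \<cdot>\<^sub>v tail_vec N k) i)) =
    (\<Sum>i = 1..N. potential \<rho> (fwd_diff u i)) +
    (if k \<in> {1..<N} then potential \<rho> (fwd_diff u k + t) - potential \<rho> (fwd_diff u k) else 0)"
proof -
  have "(\<Sum>i = 1..N. potential \<rho> (fwd_diff (u + t \<cdot>\<^sub>v tail_vec N k) i)) =
    (\<Sum>i = 1..N. potential \<rho> (fwd_diff u i) +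
      (if i = k then if k < N then potential \<rho> (fwd_diff u k + t) - potential \<rho> (fwd_diff u k)
        else 0 else 0))"
    using assms by (intro sum.cong) (auto simp: fwd_diff_add_tail_vec)
  also have "\<dots> = (\<Sum>i = 1..N. potential \<rho> (fwd_diff u i)) +
    (if k \<in> {1..N} then if k < N then potential \<rho> (fwd_diff u k + t) - potential \<rho> (fwd_diff u k)
        else 0 else 0)"
    by (simp only: sum.distrib sum.delta finite_atLeastAtMost)
  finally show ?thesis
    by auto
qed

lemma vec_norm2_power2: "(vec_norm2 v)\<^sup>2 = v \<bullet> v"
proof -
  have "0 \<le> v \<bullet> v"
    by (auto simp: scalar_prod_def intro: sum_nonneg)
  then show ?thesis
    by (simp add: vec_norm2_def)
qed

text \<open>The data come from \<open>u\<close> itself, so \<open>A *\<^sub>v u\<close> cancels and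
  the residual is \<open>t\<close> times \<open>A *\<^sub>v v\<close> minus the noise; the rest is
  the expansion of a square.\<close>

lemma vec_norm2_residual:
  assumes A: "A \<in> carrier_mat K N" and u: "u \<in> carrier_vec N" and v: "v \<in> carrier_vec N"
    and w: "w \<in> carrier_vec K"
  shows "(vec_norm2 (A *\<^sub>v (u + t \<cdot>\<^sub>v v) - (A *\<^sub>v u + w)))\<^sup>2 =
    t\<^sup>2 * ((A *\<^sub>v v) \<bullet> (A *\<^sub>v v)) - 2 * t * ((A *\<^sub>v v) \<bullet> w) + w \<bullet> w"
proof -
  define b where "b = A *\<^sub>v v"
  have b: "b \<in> carrier_vec K"
    using A v by (simp add: b_def)
  have "A *\<^sub>v (u + t \<cdot>\<^sub>v v) = A *\<^sub>v u + t \<cdot>\<^sub>v b"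
    using A u v by (simp add: mult_add_distrib_mat_vec mult_mat_vec b_def)
  then have "A *\<^sub>v (u + t \<cdot>\<^sub>v v) - (A *\<^sub>v u + w) = t \<cdot>\<^sub>v b - w"
    using A u b w by (intro eq_vecI) auto
  then have "(vec_norm2 (A *\<^sub>v (u + t \<cdot>\<^sub>v v) - (A *\<^sub>v u + w)))\<^sup>2 = (t \<cdot>\<^sub>v b - w) \<bullet> (t \<cdot>\<^sub>v b - w)"
    by (simp add: vec_norm2_power2)
  also have "\<dots> = (\<Sum>j<K. (t * b $ j - w $ j) * (t * b $ j - w $ j))"
    using b w by (simp add: scalar_prod_def lessThan_atLeast0)
  also have "\<dots> = (\<Sum>j<K. t\<^sup>2 * (b $ j * b $ j) - 2 * t * (b $ j * w $ j) + w $ j * w $ j)"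
    by (intro sum.cong) (auto simp: algebra_simps power2_eq_square)
  also have "\<dots> = t\<^sup>2 * (b \<bullet> b) - 2 * t * (b \<bullet> w) + w \<bullet> w"
    using b w by (simp add: scalar_prod_def lessThan_atLeast0 sum.distrib sum_subtractf sum_distrib_left)
  finally show ?thesis
    by (simp add: b_def)
qed

text \<open>For \<open>k = 0\<close> and \<open>k = N\<close> no difference changes along the line, but there \<open>fwd_diff u k = 0\<close>
  is a minimizer of the potential, so the inequality for the \<open>k\<close>-th difference holds all the same.\<close>

lemma minimizer_imp_subgradient:
  assumes AS1: "\<And>s. s > 0 \<Longrightarrow> \<rho> 0 < \<rho> s"
    and A: "A \<in> carrier_mat K N" and w: "w \<in> carrier_vec K"
    and min: "u \<in> global_minimizers N (energy \<rho> \<alpha> A (A *\<^sub>v u + w))"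
    and k: "k \<le> N"
  shows "\<alpha> * ((A *\<^sub>v tail_vec N k) \<bullet> w)
    \<in> limiting_subdiff (\<lambda>x. ereal (potential \<rho> x)) (fwd_diff u k)"
proof (rule regular_subgradient_imp_limiting,
    rule regular_subgradientI_quadratic[where C = "\<alpha> / 2 * ((A *\<^sub>v tail_vec N k) \<bullet> (A *\<^sub>v tail_vec N k))"])
  \<comment> \<open>Along the line the data term has a linear part, whose negated coefficient is the
    claimed subgradient, and a quadratic part, whose coefficient is the chosen
    \<open>C\<close>.\<close>
  fix t :: real
  let ?b = "A *\<^sub>v tail_vec N k"
  have u: "u \<in> carrier_vec N"
    and le: "\<And>v. v \<in> carrier_vec N \<Longrightarrow> energy \<rho> \<alpha> A (A *\<^sub>v u + w) u \<le> energy \<rho> \<alpha> A (A *\<^sub>v u + w) v"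
    using min by (auto simp: global_minimizers_def)
  \<comment> \<open>Stated for all \<open>t\<close>, since it is used at 0 too: with
    \<open>u\<close> written as the point of the line at parameter 0, both energies have the same
    form and their common terms cancel.\<close>
  have energy: "energy \<rho> \<alpha> A (A *\<^sub>v u + w) (u + t \<cdot>\<^sub>v tail_vec N k) =
      (\<Sum>i = 1..N. potential \<rho> (fwd_diff u i)) +
      (if k \<in> {1..<N} then potential \<rho> (fwd_diff u k + t) - potential \<rho> (fwd_diff u k) else 0) +
      \<alpha> / 2 * (t\<^sup>2 * (?b \<bullet> ?b) - 2 * t * (?b \<bullet> w) + w \<bullet> w)" for t
  proof -
    have "dim_vec (u + t \<cdot>\<^sub>v tail_vec N k) = N"
      by (simp add: tail_vec_def)
    then show ?thesis
      by (simp only: energy_def sum_potential_add_tail_vec[OF u]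
          vec_norm2_residual[OF A u tail_vec_carrier w])
  qed
  have zero: "u + 0 \<cdot>\<^sub>v tail_vec N k = u"
    using u by (intro eq_vecI) (auto simp: tail_vec_def)
  have "potential \<rho> 0 \<le> potential \<rho> t"
    using AS1[of "\<bar>t\<bar>"] by (cases "t = 0") (auto simp: potential_def)
  moreover have "fwd_diff u k = 0" if "k \<notin> {1..<N}"
    using that u by (auto simp: fwd_diff_def)
  ultimately have diff: "(if k \<in> {1..<N} then potential \<rho> (fwd_diff u k + t) - potential \<rho> (fwd_diff u k) else 0)
    \<le> potential \<rho> (fwd_diff u k + t) - potential \<rho> (fwd_diff u k)"
    by auto
  have "u + t \<cdot>\<^sub>v tail_vec N k \<in> carrier_vec N"
    using u by simp
  from le[OF this] have "energy \<rho> \<alpha> A (A *\<^sub>v u + w) (u + 0 \<cdot>\<^sub>v tail_vec N k)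
    \<le> energy \<rho> \<alpha> A (A *\<^sub>v u + w) (u + t \<cdot>\<^sub>v tail_vec N k)"
    by (simp only: zero)
  moreover have "energy \<rho> \<alpha> A (A *\<^sub>v u + w) (u + 0 \<cdot>\<^sub>v tail_vec N k) =
      (\<Sum>i = 1..N. potential \<rho> (fwd_diff u i)) + \<alpha> / 2 * (w \<bullet> w)"
    unfolding energy by simp
  ultimately have "0 \<le> (if k \<in> {1..<N} then potential \<rho> (fwd_diff u k + t) - potential \<rho> (fwd_diff u k) else 0)
      + \<alpha> / 2 * (t\<^sup>2 * (?b \<bullet> ?b) - 2 * t * (?b \<bullet> w))"
    unfolding energy by (simp only: distrib_left)
  also have "\<dots> \<le> potential \<rho> (fwd_diff u k + t) - potential \<rho> (fwd_diff u k)
      + \<alpha> / 2 * (t\<^sup>2 * (?b \<bullet> ?b) - 2 * t * (?b \<bullet> w))"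
    using diff by (rule add_right_mono)
  also have "\<dots> = potential \<rho> (fwd_diff u k + t) - potential \<rho> (fwd_diff u k)
      - \<alpha> * (?b \<bullet> w) * t + \<alpha> / 2 * (?b \<bullet> ?b) * t\<^sup>2"
    by (simp add: right_diff_distrib mult_ac)
  finally show "0 \<le> potential \<rho> (fwd_diff u k + t) - potential \<rho> (fwd_diff u k)
      - \<alpha> * (?b \<bullet> w) * t + \<alpha> / 2 * (?b \<bullet> ?b) * t\<^sup>2" .
qed

text \<open>The ends \<open>i = 1\<close> and \<open>i = N\<close> call on the subgradients for
  \<open>k = 0\<close> and \<open>k = N\<close>, which is why these were included before.\<close>

lemma minimizer_imp_subdiff_gap:
  assumes AS1: "\<And>s. s > 0 \<Longrightarrow> \<rho> 0 < \<rho> s"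
    and A: "A \<in> carrier_mat K N" and w: "w \<in> carrier_vec K"
    and min: "u \<in> global_minimizers N (energy \<rho> \<alpha> A (A *\<^sub>v u + w))"
    and i: "i \<in> {1..N}"
  shows "\<alpha> * (col A (i - 1) \<bullet> w) \<in> subdiff_gap \<rho> u i"
proof -
  note sub = minimizer_imp_subgradient[OF AS1 A w min]
  \<comment> \<open>Consecutive tail vectors differ in entry \<open>i - 1\<close> alone, and
    \<open>A\<close> maps this difference to its column.\<close>
  have "tail_vec N (i - 1) = tail_vec N i + unit_vec N (i - 1)"
    using i by (intro eq_vecI) (auto simp: tail_vec_def unit_vec_def)
  then have "A *\<^sub>v tail_vec N (i - 1) = A *\<^sub>v tail_vec N i + A *\<^sub>v unit_vec N (i - 1)"
    using A by (simp add: mult_add_distrib_mat_vec)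
  also have "A *\<^sub>v unit_vec N (i - 1) = col A (i - 1)"
    using A i by (intro eq_vecI) auto
  finally have sum: "A *\<^sub>v tail_vec N (i - 1) = A *\<^sub>v tail_vec N i + col A (i - 1)" .
  have "(A *\<^sub>v tail_vec N (i - 1)) \<bullet> w = (A *\<^sub>v tail_vec N i) \<bullet> w + col A (i - 1) \<bullet> w"
    unfolding sum using A w by (intro add_scalar_prod_distrib) auto
  then have "\<alpha> * (col A (i - 1) \<bullet> w) =
    \<alpha> * ((A *\<^sub>v tail_vec N (i - 1)) \<bullet> w) - \<alpha> * ((A *\<^sub>v tail_vec N i) \<bullet> w)"
    by (simp only: distrib_left add_diff_cancel_left')
  moreover have "\<alpha> * ((A *\<^sub>v tail_vec N (i - 1)) \<bullet> w)
      \<in> limiting_subdiff (\<lambda>x. ereal (potential \<rho> x)) (fwd_diff u (i - 1))"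
    using i by (intro sub) auto
  moreover have "\<alpha> * ((A *\<^sub>v tail_vec N i) \<bullet> w)
      \<in> limiting_subdiff (\<lambda>x. ereal (potential \<rho> x)) (fwd_diff u i)"
    using i by (intro sub) auto
  ultimately show ?thesis
    unfolding subdiff_gap_def by blast
qed

section \<open>Probabilities of intervals\<close>

interpretation std_normal: real_distribution std_normal_distribution
  by (rule real_dist_normal_dist)

lemma std_normal_cdf_le: "std_normal_cdf x = measure std_normal_distribution {y. ereal y \<le> x}"
proof (cases x)
  case (real r)
  then show ?thesis
    by (simp add: std_normal_cdf_def cdf_def atMost_def)
next
  case PInf
  then show ?thesis
    using std_normal.prob_space by (simp add: std_normal_cdf_def)
qed (simp add: std_normal_cdf_def)

lemma std_normal_no_atom: "measure std_normal_distribution {r} = 0"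
  by (simp add: measure_def emeasure_density nn_integral_indicator_singleton)

text \<open>A closed interval arises by removing the points strictly below its lower end, so the
  strict form is wanted there; it agrees with the other one because the normal law has no
  atoms.\<close>

lemma std_normal_cdf_less: "std_normal_cdf x = measure std_normal_distribution {y. ereal y < x}"
proof (cases x)
  case (real r)
  have "{y. ereal y \<le> x} = {y. ereal y < x} \<union> {r}"
    using real by auto
  then have "measure std_normal_distribution {y. ereal y \<le> x} =
      measure std_normal_distribution {y. ereal y < x} + measure std_normal_distribution {r}"
    using real by (simp only:) (subst std_normal.finite_measure_Union, auto)
  then show ?thesis
    by (simp add: std_normal_cdf_le std_normal_no_atom)
next
  case PInf
  then show ?thesis
    using std_normal.prob_space by (simp add: std_normal_cdf_def)
qed (simp add: std_normal_cdf_def)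

lemma std_normal_interval:
  assumes "lo \<le> hi"
  shows "measure std_normal_distribution {y. lo \<le> ereal y \<and> ereal y \<le> hi}
    = std_normal_cdf hi - std_normal_cdf lo"
proof -
  have "{y. lo \<le> ereal y \<and> ereal y \<le> hi} = {y. ereal y \<le> hi} - {y. ereal y < lo}"
    by auto
  moreover have "{y. ereal y < lo} \<subseteq> {y. ereal y \<le> hi}"
    using assms by auto
  ultimately show ?thesis
    by (simp add: std_normal_cdf_le[of hi] std_normal_cdf_less[of lo] std_normal.finite_measure_Diff)
qed

section \<open>The closed hull of the gap as an event\<close>

definition gap_event ::
  "(real \<Rightarrow> real) \<Rightarrow> real \<Rightarrow> real vec \<Rightarrow> nat \<Rightarrow> real set" where
  "gap_event \<rho> \<alpha> u i =
     {y. subdiff_gap \<rho> u i \<noteq> {} \<and> (INF g \<in> subdiff_gap \<rho> u i. ereal g) \<le> ereal (\<alpha> * y) \<and>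
         ereal (\<alpha> * y) \<le> (SUP g \<in> subdiff_gap \<rho> u i. ereal g)}"

lemma gap_event_borel [measurable]: "gap_event \<rho> \<alpha> u i \<in> sets borel"
  unfolding gap_event_def by measurable

text \<open>Replacing the gap by the closed interval that it spans yields a Borel set whatever the
  shape of the gap, and its probability is the difference of distribution values in
  \<open>prob_bound\<close>.\<close>

lemma gap_eventI: "\<alpha> * y \<in> subdiff_gap \<rho> u i \<Longrightarrow> y \<in> gap_event \<rho> \<alpha> u i"
  unfolding gap_event_def by (auto intro: INF_lower SUP_upper)

text \<open>Dividing \<open>Y\<close> by its standard deviation reduces the claim to the standard
  normal law; the factor \<alpha> in the event supplies the rest of the denominator in
  \<open>prob_bound\<close>.\<close>

lemma (in prob_space) prob_gap_event:
  assumes Y: "distributed M lborel Y (normal_density 0 (\<sigma> * vec_norm2 (col A (i - 1))))"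
    and pos: "\<alpha> > 0" "\<sigma> > 0" "vec_norm2 (col A (i - 1)) > 0"
  shows "prob (Y -` gap_event \<rho> \<alpha> u i \<inter> space M) = prob_bound \<rho> \<alpha> \<sigma> A u i"
proof (cases "subdiff_gap \<rho> u i = {}")
  case True
  then show ?thesis
    by (simp add: gap_event_def prob_bound_def)
next
  case False
  define c where "c = vec_norm2 (col A (i - 1))"
  define lo where "lo = (INF g \<in> subdiff_gap \<rho> u i. ereal g)"
  define hi where "hi = (SUP g \<in> subdiff_gap \<rho> u i. ereal g)"
  have le: "lo \<le> hi"
    unfolding lo_def hi_def using False by (intro INF_le_SUP)
  have c: "c > 0" "\<alpha> * \<sigma> * c > 0"
    using pos by (auto simp: c_def)
  define Z where "Z = (\<lambda>\<omega>. Y \<omega> / (\<sigma> * c))"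
  have Z: "distributed M lborel Z std_normal_density"
    using Y normal_standard_normal_convert[of "\<sigma> * c" Y 0] pos c by (simp add: Z_def c_def)
  define I where "I = {y. lo / ereal (\<alpha> * \<sigma> * c) \<le> ereal y \<and> ereal y \<le> hi / ereal (\<alpha> * \<sigma> * c)}"
  have "gap_event \<rho> \<alpha> u i = (\<lambda>y. y / (\<sigma> * c)) -` I"
  proof -
    \<comment> \<open>The division rules for \<open>ereal\<close>, valid also for infinite
      \<open>lo\<close> and \<open>hi\<close>, produce this product;
      \<open>times_ereal.simps\<close> is removed below so that the product survives until this
      equation rewrites it.\<close>
    have "ereal (\<alpha> * \<sigma> * c) * ereal (y / (\<sigma> * c)) = ereal (\<alpha> * y)" for y
      using pos c by simp
    moreover have "0 < ereal (\<alpha> * \<sigma> * c)"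
      using c by simp
    ultimately show ?thesis
      using False c by (auto simp: gap_event_def I_def lo_def[symmetric] hi_def[symmetric]
          ereal_divide_le_pos ereal_le_divide_pos simp del: times_ereal.simps)
  qed
  then have "prob (Y -` gap_event \<rho> \<alpha> u i \<inter> space M) = prob (Z -` I \<inter> space M)"
    by (simp add: Z_def vimage_def)
  also have "\<dots> = measure (distr M lborel Z) I"
    using distributed_measurable[OF Z] by (subst measure_distr) (auto simp: I_def)
  also have "\<dots> = measure std_normal_distribution I"
    by (simp add: distributed_distr_eq_density[OF Z])
  also have "\<dots> = std_normal_cdf (hi / ereal (\<alpha> * \<sigma> * c)) - std_normal_cdf (lo / ereal (\<alpha> * \<sigma> * c))"
    unfolding I_def using le c by (intro std_normal_interval ereal_divide_right_mono) auto
  finally show ?thesis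
    using False by (simp add: prob_bound_def lo_def hi_def c_def)
qed

section \<open>Normal law of linear combinations of the noise\<close>

lemma nonzero_vec_entry:
  assumes "a \<in> carrier_vec K" "a \<noteq> 0\<^sub>v K"
  obtains j where "j < K" "a $ j \<noteq> 0"
  using assms eq_vecI[of a "0\<^sub>v K"] by auto

lemma vec_norm2_pos:
  assumes "a \<in> carrier_vec K" "a \<noteq> 0\<^sub>v K"
  shows "vec_norm2 a > 0"
proof -
  obtain j where "j < K" "a $ j \<noteq> 0"
    using nonzero_vec_entry[OF assms] .
  then have "0 < (\<Sum>j<K. a $ j * a $ j)"
    by (intro sum_pos2[of _ j]) (auto simp: zero_less_mult_iff)
  then show ?thesis
    using assms(1) by (simp add: vec_norm2_def scalar_prod_def lessThan_atLeast0)
qed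

lemma (in prob_space) distributed_scalar_prod_normal:
  assumes indep: "indep_vars (\<lambda>_. borel) n {..<K}"
    and normal: "\<And>j. j < K \<Longrightarrow> distributed M lborel (n j) (normal_density 0 \<sigma>)"
    and \<sigma>: "\<sigma> > 0" and a: "a \<in> carrier_vec K" "a \<noteq> 0\<^sub>v K"
  shows "distributed M lborel (\<lambda>\<omega>. a \<bullet> vec K (\<lambda>j. n j \<omega>)) (normal_density 0 (\<sigma> * vec_norm2 a))"
proof -
  \<comment> \<open>\<open>sum_indep_normal\<close> asks for a nonempty index set and positive
    standard deviations, so the zero coefficients are dropped; \<open>a\<close> being nonzero leaves
    at least one index.\<close>
  define J where "J = {j \<in> {..<K}. a $ j \<noteq> 0}"
  have "J \<noteq> {}" "finite J"
    using nonzero_vec_entry[OF a] by (auto simp: J_def)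
  have "indep_vars (\<lambda>_. borel) (\<lambda>j \<omega>. a $ j * n j \<omega>) J"
    using indep_vars_compose2[OF indep_vars_subset[OF indep], of J "\<lambda>j x. a $ j * x" "\<lambda>_. borel"]
    by (auto simp: J_def)
  moreover have "distributed M lborel (\<lambda>\<omega>. a $ j * n j \<omega>) (normal_density 0 (\<bar>a $ j\<bar> * \<sigma>))"
    if "j \<in> J" for j
    using normal_density_affine[OF normal \<sigma>, of j "a $ j" 0] that by (simp add: J_def)
  ultimately have "distributed M lborel (\<lambda>\<omega>. \<Sum>j\<in>J. a $ j * n j \<omega>)
      (normal_density (\<Sum>j\<in>J. 0) (sqrt (\<Sum>j\<in>J. (\<bar>a $ j\<bar> * \<sigma>)\<^sup>2)))"
    using \<open>J \<noteq> {}\<close> \<open>finite J\<close> \<sigma> by (intro sum_indep_normal) (auto simp: J_def)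
  moreover have "(\<Sum>j\<in>J. a $ j * n j \<omega>) = a \<bullet> vec K (\<lambda>j. n j \<omega>)" for \<omega>
  proof -
    have "(\<Sum>j\<in>J. a $ j * n j \<omega>) = (\<Sum>j<K. a $ j * n j \<omega>)"
      by (rule sum.mono_neutral_left) (auto simp: J_def)
    then show ?thesis
      by (simp add: scalar_prod_def lessThan_atLeast0)
  qed
  moreover have "sqrt (\<Sum>j\<in>J. (\<bar>a $ j\<bar> * \<sigma>)\<^sup>2) = \<sigma> * vec_norm2 a"
  proof -
    have "(\<Sum>j\<in>J. (\<bar>a $ j\<bar> * \<sigma>)\<^sup>2) = (\<Sum>j<K. (\<bar>a $ j\<bar> * \<sigma>)\<^sup>2)"
      by (rule sum.mono_neutral_left) (auto simp: J_def)
    also have "\<dots> = \<sigma>\<^sup>2 * (a \<bullet> a)"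
      using a by (simp add: scalar_prod_def lessThan_atLeast0 power_mult_distrib sum_distrib_left
          power2_eq_square mult_ac)
    finally show ?thesis
      using \<sigma> by (simp add: vec_norm2_def real_sqrt_mult)
  qed
  ultimately show ?thesis
    by simp
qed

text \<open>The gap has at most one element: if empty, the bound is 0 by definition; if a singleton,
  supremum and infimum coincide and the two distribution values cancel.\<close>

lemma prob_bound_C1:
  assumes "potential \<rho> C1_differentiable_on UNIV"
  shows "prob_bound \<rho> \<alpha> \<sigma> A u i = 0"
proof -
  obtain D where D: "\<And>x. (potential \<rho> has_real_derivative D x) (at x)" "continuous_on UNIV D"
    using assms by (auto simp: C1_differentiable_on_def has_real_derivative_iff_has_vector_derivative)
  have "subdiff_gap \<rho> u i \<subseteq> {D (fwd_diff u (i - 1)) - D (fwd_diff u i)}"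
    using limiting_subdiff_C1[OF D] unfolding subdiff_gap_def by blast
  then show ?thesis
    by (auto simp: prob_bound_def subset_singleton_iff)
qed

section \<open>Bounds on the recovery probability\<close>

theorem proposition4p2:
  fixes \<rho> :: "real \<Rightarrow> real" and \<alpha> \<sigma> :: real
    and N K :: nat
    and A :: "real mat" and u0 :: "real vec"
    and M :: "'w measure" and n :: "nat \<Rightarrow> 'w \<Rightarrow> real"
  assumes AS1: "\<rho> 0 = 0" "\<And>s. s > 0 \<Longrightarrow> \<rho> 0 < \<rho> s"
    and AS2: "mono_on {0..} \<rho>"
    and pos: "\<alpha> > 0" "\<sigma> > 0"
    and N: "N \<ge> 1"
    and A: "A \<in> carrier_mat K N"
    and cols: "\<And>i. i \<in> {1..N} \<Longrightarrow> col A (i - 1) \<noteq> 0\<^sub>v K"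
    and u0: "u0 \<in> carrier_vec N"
    and M: "prob_space M"
    and indep: "prob_space.indep_vars M (\<lambda>_. borel) n {..<K}"
    and normal: "\<And>j. j < K \<Longrightarrow> distributed M lborel (n j) (normal_density 0 \<sigma>)"
  shows "recovery_prob M n \<rho> \<alpha> A u0 \<le> Min {prob_bound \<rho> \<alpha> \<sigma> A u0 i | i. i \<in> {1..N}} \<and>
    (A = 1\<^sub>m N \<longrightarrow>
       recovery_prob M n \<rho> \<alpha> A u0 \<le> (\<Prod>i = 1..N. prob_bound \<rho> \<alpha> \<sigma> A u0 i) \<and>
       (\<forall>i \<in> {1..N}. vec_norm2 (col A (i - 1)) = 1)) \<and>
    (potential \<rho> C1_differentiable_on UNIV \<longrightarrow> recovery_prob M n \<rho> \<alpha> A u0 = 0)"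
proof -
  interpret prob_space M
    by (rule M)
  let ?P = "recovery_prob M n \<rho> \<alpha> A u0"
  define Y where "Y i \<omega> = col A (i - 1) \<bullet> vec K (\<lambda>j. n j \<omega>)" for i \<omega>
  define S where "S i = Y i -` gap_event \<rho> \<alpha> u0 i \<inter> space M" for i
  define R where "R = {\<omega> \<in> space M. let f = A *\<^sub>v u0 + vec (dim_row A) (\<lambda>j. n j \<omega>)
       in u0 \<in> global_minimizers (dim_col A) (energy \<rho> \<alpha> A f)}"
  have P: "?P = prob R"
    by (simp add: recovery_prob_def R_def)
  have dims: "dim_row A = K" "dim_col A = N"
    using A by auto
  have colK: "col A (i - 1) \<in> carrier_vec K" for i
    using A by auto
  have dist: "distributed M lborel (Y i) (normal_density 0 (\<sigma> * vec_norm2 (col A (i - 1))))"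
    if "i \<in> {1..N}" for i
    unfolding Y_def using distributed_scalar_prod_normal[OF indep normal pos(2) colK cols[OF that]]
    by simp
  have S: "S i \<in> events" "prob (S i) = prob_bound \<rho> \<alpha> \<sigma> A u0 i" if "i \<in> {1..N}" for i
  proof -
    show "S i \<in> events"
      using distributed_measurable[OF dist[OF that]] unfolding S_def by measurable
    show "prob (S i) = prob_bound \<rho> \<alpha> \<sigma> A u0 i"
      unfolding S_def using dist[OF that] pos vec_norm2_pos[OF colK cols[OF that]]
      by (intro prob_gap_event)
  qed
  \<comment> \<open>The recovery event is enclosed in each measurable event \<open>S i\<close>;
    monotonicity of the measure asks for measurability of the larger set.\<close>
  have RS: "R \<subseteq> S i" if "i \<in> {1..N}" for i
  proof
    fix \<omega> assume "\<omega> \<in> R"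
    then have \<omega>: "\<omega> \<in> space M"
      and min: "u0 \<in> global_minimizers N (energy \<rho> \<alpha> A (A *\<^sub>v u0 + vec K (\<lambda>j. n j \<omega>)))"
      by (simp_all add: R_def Let_def dims)
    have "\<alpha> * Y i \<omega> \<in> subdiff_gap \<rho> u0 i"
      unfolding Y_def using min that
      by (intro minimizer_imp_subdiff_gap[where A = A and K = K and N = N] AS1(2) A) auto
    with \<omega> show "\<omega> \<in> S i"
      by (auto simp: S_def intro: gap_eventI)
  qed
  have le: "?P \<le> prob_bound \<rho> \<alpha> \<sigma> A u0 i" if "i \<in> {1..N}" for i
    unfolding P using finite_measure_mono[OF RS[OF that]] S[OF that] by simp
  have 1: "?P \<le> Min {prob_bound \<rho> \<alpha> \<sigma> A u0 i | i. i \<in> {1..N}}"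
    using N le by (subst Min_ge_iff) auto
  have 2: "?P \<le> (\<Prod>i = 1..N. prob_bound \<rho> \<alpha> \<sigma> A u0 i) \<and>
      (\<forall>i \<in> {1..N}. vec_norm2 (col A (i - 1)) = 1)" if "A = 1\<^sub>m N"
  proof
    have KN: "K = N"
      using A that by auto
    \<comment> \<open>Both the finite intersection of events and \<open>indep_varsD\<close> ask for
      a nonempty index set.\<close>
    have ne: "{..<N} \<noteq> {}"
      using N by (simp add: lessThan_empty_iff)
    \<comment> \<open>Column \<open>j\<close> of the identity is a unit vector, so the projection is
      the noise entry itself; \<open>Suc\<close> translates from zero-based entries to one-based
      differences.\<close>
    have Y: "Y (Suc j) \<omega> = n j \<omega>" if "j < N" for j \<omega>
      using that by (simp add: Y_def \<open>A = 1\<^sub>m N\<close> KN)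
    have SY: "S (Suc j) = n j -` gap_event \<rho> \<alpha> u0 (Suc j) \<inter> space M" if "j < N" for j
      using Y[OF that] by (auto simp: S_def)
    have "R \<subseteq> (\<Inter>j<N. S (Suc j))"
      using N by (intro INF_greatest RS) auto
    moreover have "(\<Inter>j<N. S (Suc j)) \<in> events"
      using ne S by (intro sets.finite_INT) auto
    ultimately have "?P \<le> prob (\<Inter>j<N. S (Suc j))"
      unfolding P by (rule finite_measure_mono)
    also have "\<dots> = prob (\<Inter>j<N. n j -` gap_event \<rho> \<alpha> u0 (Suc j) \<inter> space M)"
      using SY by (intro arg_cong[where f = prob] INF_cong) auto
    \<comment> \<open>Here independence of the noise entries turns the intersection into a
      product.\<close>
    also have "\<dots> = (\<Prod>j<N. prob (n j -` gap_event \<rho> \<alpha> u0 (Suc j) \<inter> space M))"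
      using indep ne by (intro indep_varsD[where I = "{..<K}"]) (auto simp: KN)
    also have "\<dots> = (\<Prod>j<N. prob_bound \<rho> \<alpha> \<sigma> A u0 (Suc j))"
    proof (rule prod.cong)
      fix j assume "j \<in> {..<N}"
      then show "prob (n j -` gap_event \<rho> \<alpha> u0 (Suc j) \<inter> space M) = prob_bound \<rho> \<alpha> \<sigma> A u0 (Suc j)"
        using SY[of j] S(2)[of "Suc j"] by simp
    qed simp
    also have "\<dots> = (\<Prod>i = 1..N. prob_bound \<rho> \<alpha> \<sigma> A u0 i)"
      by (rule prod.reindex_bij_witness[of _ "\<lambda>i. i - 1" Suc]) auto
    finally show "?P \<le> (\<Prod>i = 1..N. prob_bound \<rho> \<alpha> \<sigma> A u0 i)" .
    show "\<forall>i \<in> {1..N}. vec_norm2 (col A (i - 1)) = 1"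
    proof
      fix i assume "i \<in> {1..N}"
      then have "col A (i - 1) = unit_vec N (i - 1)" "i - 1 < N"
        by (auto simp: that)
      then show "vec_norm2 (col A (i - 1)) = 1"
        by (simp add: vec_norm2_def)
    qed
  qed
  \<comment> \<open>Proved for every \<open>A\<close>, not only the identity: the single bound at
    \<open>i = 1\<close> is already 0.\<close>
  have 3: "?P = 0" if "potential \<rho> C1_differentiable_on UNIV"
    using le[of 1] N prob_bound_C1[OF that] measure_nonneg[of M R] by (simp add: P)
  show ?thesis
    using 1 2 3 by blast
qed

end
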